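(* If $E(\lambda)$ is a $*$-even $n\times n$ matrix pencil with $\operatorname{rank}E=r\leq n$, then it can be written as $$E(\lambda)=(a_1+\lambda(b_1\mathfrak i))u_1u_1^*+\cdots+(a_\ell+\lambda(b_\ell\mathfrak i))u_\ell u_\ell^*+v_1w_1(\lambda)^*+\cdots+v_sw_s(\lambda)^*+w_1(-\lambda)v_1^*+\cdots+w_s(-\lambda)v_s^*,$$ where $\mathfrak i$ is the imaginary unit, $a_i,b_i\in\mathbb R$ for $i=1,\dots,\ell$, $u_i,v_j,w_j\in\mathbb C[\lambda]^n$, and (i) $\ell+2s=r$; (ii) $\deg u_1=\cdots=\deg u_\ell=0=\deg v_1=\cdots=\deg v_s$ and $\deg w_1,\dots,\deg w_s\leq 1$.
   Context: A matrix pencil $E(\lambda)=A+\lambda B$ with $A,B\in\mathbb C^{n\times n}$ is $*$-even if $A^*=A$ and $B^*=-B$. Its rank is the normal rank, i.e. the rank as a matrix over the field of rational functions, $\max_{\lambda\in\mathbb C}\operatorname{rank}(A+\lambda B)$. For $v(\lambda)\in\mathbb C[\lambda]^n$, $\deg v$ is the largest degree of the entries of $v$; so $\deg v=0$ means that $v$ is a constant vector in $\mathbb C^n$. For $w(\lambda)=w_0+\lambda w_1$ with $w_0,w_1\in\mathbb C^n$, $w(\lambda)^*$ denotes $w_0^*+\lambda w_1^*$ (conjugate transpose is applied to coefficients only, not to $\lambda$). *)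

theory Defs
  imports
    "HOL-Computational_Algebra.Computational_Algebra"
    "Jordan_Normal_Form.Schur_Decomposition"
    "Jordan_Normal_Form.DL_Rank"
begin

definition pencil :: "complex mat \<Rightarrow> complex mat \<Rightarrow> complex poly mat" where
  "pencil A B = map_mat (\<lambda>a. [:a:]) A + [:0, 1:] \<cdot>\<^sub>m map_mat (\<lambda>b. [:b:]) B"

definition star_even_pencil :: "nat \<Rightarrow> complex poly mat \<Rightarrow> bool" where
  "star_even_pencil n E \<longleftrightarrow>
     (\<exists>A\<in>carrier_mat n n. \<exists>B\<in>carrier_mat n n.
        mat_adjoint A = A \<and> mat_adjoint B = - B \<and> E = pencil A B)"

text \<open>The normal rank is the rank over the field of rational functions,
  that is, the fraction field of the polynomial ring.\<close>

definition normal_rank :: "complex poly mat \<Rightarrow> nat" where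
  "normal_rank E = vec_space.rank (dim_row E) (map_mat to_fract E)"

text \<open>Since \<^const>\<open>degree\<close> assigns 0 to the zero polynomial, a polynomial vector has degree 0
  iff it is constant, the zero vector included. The inserted 0 only matters for the
  vector with no entries.\<close>

definition vec_degree :: "complex poly vec \<Rightarrow> nat" where
  "vec_degree v = Max (insert 0 (degree ` set\<^sub>v v))"

text \<open>The product \<open>v(\<lambda>) w(\<lambda>)\<^sup>*\<close>: conjugation acts on the coefficients only and leaves
  the indeterminate unchanged.\<close>

definition mult_star :: "complex poly vec \<Rightarrow> complex poly vec \<Rightarrow> complex poly mat" where
  "mult_star v w = mat (dim_vec v) (dim_vec w) (\<lambda>(i, j). v $ i * map_poly cnj (w $ j))"

text \<open>The vector \<open>w(-\<lambda>)\<close>.\<close>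

definition reflect_vec :: "complex poly vec \<Rightarrow> complex poly vec" where
  "reflect_vec w = map_vec (\<lambda>p. pcompose p [:0, -1:]) w"

text \<open>Matrices of all dimensions share one type, so there is no zero matrix for
  the generic \<^const>\<open>sum\<close>; sums of \<open>n \<times> n\<close> matrices are formed entrywise.\<close>

definition mat_sum :: "nat \<Rightarrow> ('i \<Rightarrow> 'a::comm_monoid_add mat) \<Rightarrow> 'i set \<Rightarrow> 'a mat" where
  "mat_sum n F I = mat n n (\<lambda>(i, j). \<Sum>k\<in>I. F k $$ (i, j))"

end

theory Submission
  imports Defs
begin

text \<open>
  The proof is a Wedderburn rank reduction that respects the symmetry. Let \<open>p \<mapsto> p\<^sup>*\<close> conjugate the
  coefficients of a polynomial and replace \<open>\<lambda>\<close> by \<open>-\<lambda>\<close>, and extend this to matrices by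
  transposition. This is an involution of \<open>\<complex>[\<lambda>]\<close>, and a pencil \<open>E\<close> is \<open>*\<close>-even iff \<open>E\<^sup>* = E\<close>. In this
  notation the terms of the decomposition are \<open>q u u\<^sup>*\<close> with \<open>q\<^sup>* = q\<close> and \<open>v \<omega>\<^sup>* + \<omega> v\<^sup>*\<close> with
  \<open>\<omega>(\<lambda>) = w(-\<lambda>)\<close>.

  Suppose that \<open>E \<noteq> 0\<close>. There are constant vectors \<open>x\<close> and \<open>y \<noteq> 0\<close> and a nonzero polynomial \<open>p\<close> of
  degree at most one such that \<open>E x = p y\<close> (\<open>para_hermitian_pencil_eigenvector\<close>). This holds for
  singular pencils too: either the leading coefficient has a kernel vector that the constant one
  does not annihilate, or there is a finite eigenvector outside the common kernel
  (\<open>relative_eigenvector\<close>). So no Kronecker canonical form is involved. Now there are two cases.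

  If \<open>x\<^sup>* y \<noteq> 0\<close>, scale so that \<open>E x = q u\<close> with \<open>x\<^sup>* u = 1\<close>. Then \<open>q = x\<^sup>* E x\<close> is fixed by the involution,
  hence of the form \<open>a + \<lambda> b \<i>\<close>, and \<open>E - q u u\<^sup>*\<close> has one rank less
  (\<open>para_hermitian_split_nonisotropic\<close>).

  If \<open>x\<^sup>* y = 0\<close>, choose \<open>z\<close> with \<open>y\<^sup>* z = 1\<close> and put \<open>\<omega> = E z - (z\<^sup>* E z / 2) y\<close>. Then
  \<open>E - y \<omega>\<^sup>* - \<omega> y\<^sup>*\<close> annihilates \<open>x\<close> and \<open>z\<close> and has two ranks less
  (\<open>para_hermitian_split_isotropic\<close>).

  In both cases the remainder is again \<open>*\<close>-even. The induction on the normal rank therefore ends at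
  the zero pencil, with \<open>\<ell> + 2 s\<close> equal to the initial rank. That the ranks drop by exactly these
  amounts is \<open>rank_add_outer\<close>.
\<close>

section \<open>Rank-one updates\<close>

definition outer :: "'a::times vec \<Rightarrow> 'a vec \<Rightarrow> 'a mat" where
  "outer a b = mat (dim_vec a) (dim_vec b) (\<lambda>(i, j). a $ i * b $ j)"

lemma outer_carrier [simp, intro]:
  "a \<in> carrier_vec n \<Longrightarrow> b \<in> carrier_vec m \<Longrightarrow> outer a b \<in> carrier_mat n m"
  unfolding outer_def by (metis carrier_vecD mat_carrier)

lemma index_outer [simp]:
  "i < dim_vec a \<Longrightarrow> j < dim_vec b \<Longrightarrow> outer a b $$ (i, j) = a $ i * b $ j"
  "dim_row (outer a b) = dim_vec a" "dim_col (outer a b) = dim_vec b"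
  by (simp_all add: outer_def)

lemma outer_mult_vec:
  fixes a b g :: "'a::comm_semiring_0 vec"
  assumes "dim_vec g = dim_vec b"
  shows "outer a b *\<^sub>v g = (b \<bullet> g) \<cdot>\<^sub>v a"
  using assms by (intro eq_vecI) (auto simp: scalar_prod_def sum_distrib_left ac_simps)

lemma mult_outer:
  fixes M :: "'a::comm_semiring_0 mat"
  assumes "M \<in> carrier_mat n m" "a \<in> carrier_vec m"
  shows "M * outer a b = outer (M *\<^sub>v a) b"
  using assms by (intro eq_matI) (auto simp: scalar_prod_def sum_distrib_right mult.assoc)

context vec_space
begin

lemma dim_span_insert:
  assumes S: "S \<subseteq> carrier_vec n" "finite S" and a: "a \<in> carrier_vec n" "a \<notin> span S"
  shows "vectorspace.dim class_ring (span_vs (insert a S))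
    = Suc (vectorspace.dim class_ring (span_vs S))"
proof -
  obtain U where U: "finite U" "maximal U (\<lambda>T. T \<subseteq> S \<and> lin_indpt T)"
    using maximal_exists_superset[of S "\<lambda>T. T \<subseteq> S \<and> lin_indpt T" "{}"] S(2)
      finite_lin_indpt2[of "{}"] by auto
  hence US: "U \<subseteq> S" and Ui: "lin_indpt U" by (auto simp: maximal_def)
  have aS: "a \<notin> S" using span_mem[of S a] S a by auto
  have aU: "a \<notin> span U" using span_is_monotone[OF US] a by blast
  have ind: "lin_indpt (insert a U)"
    using lin_dep_iff_in_span[of U a] US Ui a aS aU S by auto
  have max: "maximal (insert a U) (\<lambda>T. T \<subseteq> insert a S \<and> lin_indpt T)"
    unfolding maximal_def
  proof (intro conjI allI impI)
    fix T assume T: "insert a U \<subseteq> T \<and> T \<subseteq> insert a S \<and> lin_indpt T"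
    hence "lin_indpt (T - {a})" using subset_li_is_li[of T "T - {a}"] by auto
    moreover have "U \<subseteq> T - {a}" "T - {a} \<subseteq> S" using T aS US by auto
    ultimately have "U = T - {a}" using U(2) unfolding maximal_def by blast
    thus "T = insert a U" using T by auto
  qed (use US ind in auto)
  \<comment> \<open>A maximal independent subset of S together with a is maximal in the enlarged set.\<close>
  have "vectorspace.dim class_ring (span_vs (insert a S)) = card (insert a U)"
    by (rule dim_span[OF _ _ max]) (use S a in auto)
  moreover have "vectorspace.dim class_ring (span_vs S) = card U"
    by (rule dim_span[OF _ _ U(2)]) (use S in auto)
  moreover have "a \<notin> U" using aS US by auto
  ultimately show ?thesis using U(1) by simp
qed

text \<open>The vector \<open>z\<close> shows that the column space of the sum contains \<open>a\<close>, hence is spanned by \<open>a\<close>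
and the columns of \<open>M\<close>; the functional \<open>t\<close> kills the latter but not \<open>a\<close>. So the dimension grows
by exactly one. The same lemma counts the rank of constant Hermitian matrices and the normal
rank of pencils.\<close>

lemma rank_add_outer:
  assumes M: "M \<in> carrier_mat n m" and a: "a \<in> carrier_vec n" and b: "b \<in> carrier_vec m"
    and t: "t \<in> carrier_vec n" and z: "z \<in> carrier_vec m"
    and tM: "transpose_mat M *\<^sub>v t = 0\<^sub>v m" and ta: "t \<bullet> a \<noteq> 0"
    and Mz: "M *\<^sub>v z = 0\<^sub>v n" and bz: "b \<bullet> z \<noteq> 0"
  shows "rank (M + outer a b) = Suc (rank M)"
proof -
  let ?N = "M + outer a b"
  let ?S = "set (cols M)"
  have N: "?N \<in> carrier_mat n m" using M a b by auto
  have SM: "?S \<subseteq> carrier_vec n" and SN: "set (cols ?N) \<subseteq> carrier_vec n"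
    using cols_dim[of M] cols_dim[of ?N] M N by (simp_all only: carrier_matD)
  have a_notin: "a \<notin> span ?S"
  proof
    assume "a \<in> span ?S"
    then obtain g where g: "g \<in> carrier_vec m" "M *\<^sub>v g = a"
      using col_space_eq[OF M] M by (auto simp: col_space_def)
    hence "t \<bullet> a = (transpose_mat M *\<^sub>v t) \<bullet> g"
      using transpose_vec_mult_scalar[OF M, of g t] t by auto
    thus False using ta tM g by simp
  qed
  have colN: "col ?N j = col M j + (b $ j) \<cdot>\<^sub>v a" if "j < m" for j
    using that M a b by (intro eq_vecI) auto
  have "?N *\<^sub>v z = M *\<^sub>v z + outer a b *\<^sub>v z"
    using M a b z by (intro add_mult_distrib_mat_vec) auto
  also have "\<dots> = (b \<bullet> z) \<cdot>\<^sub>v a" using Mz a b z by (simp add: outer_mult_vec)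
  finally have Nz: "?N *\<^sub>v ((1 / (b \<bullet> z)) \<cdot>\<^sub>v z) = a"
    using mult_mat_vec[OF N z, of "1 / (b \<bullet> z)"] bz by (simp add: smult_smult_assoc)
  have "a \<in> col_space ?N"
    unfolding col_space_eq[OF N] using Nz N a z by (intro CollectI conjI bexI[of _ "(1 / (b \<bullet> z)) \<cdot>\<^sub>v z"]) auto
  hence a_in: "a \<in> span (set (cols ?N))" by (simp add: col_space_def)
  have SaM: "insert a ?S \<subseteq> carrier_vec n" using SM a by simp
  have sub: "x + c \<cdot>\<^sub>v a \<in> span T"
    if "T \<subseteq> carrier_vec n" "x \<in> span T" "a \<in> span T" for x c T
    using span_add1[of T x "c \<cdot>\<^sub>v a"] smult_in_span[of T a c] that by simp
  have "span (set (cols ?N)) = span (insert a ?S)"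
  proof (rule equalityI; rule span_subsetI)
    show "set (cols ?N) \<subseteq> span (insert a ?S)"
    proof
      fix v assume "v \<in> set (cols ?N)"
      then obtain j where j: "j < m" "v = col ?N j" using N by (auto simp: cols_def)
      have "col M j \<in> span (insert a ?S)" "a \<in> span (insert a ?S)"
        using span_mem[of "insert a ?S"] SaM j M by (auto simp: cols_def)
      thus "v \<in> span (insert a ?S)" unfolding j(2) colN[OF j(1)] by (intro sub SaM)
    qed
    show "insert a ?S \<subseteq> span (set (cols ?N))"
    proof
      fix v assume "v \<in> insert a ?S"
      moreover have "v \<in> span (set (cols ?N))" if "v \<in> ?S"
      proof -
        from that obtain j where j: "j < m" "v = col M j" using M by (auto simp: cols_def)
        have v: "v = col ?N j + (- (b $ j)) \<cdot>\<^sub>v a"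
          unfolding colN[OF j(1)] j(2) using M a j by (intro eq_vecI) auto
        have "col ?N j \<in> span (set (cols ?N))"
          using span_mem[of "set (cols ?N)"] SN j(1) N by (auto simp: cols_def)
        thus ?thesis unfolding v using SN a_in by (intro sub)
      qed
      ultimately show "v \<in> span (set (cols ?N))" using a_in by blast
    qed
  qed (use SN SaM in auto)
  thus ?thesis unfolding rank_def
    using dim_span_insert[OF SM _ a a_notin] by simp
qed

end

section \<open>Eigenvectors of a pair of Hermitian matrices\<close>

lemma mat_adjoint_carrier:
  "A \<in> carrier_mat n m \<Longrightarrow> mat_adjoint A \<in> carrier_mat m n"
  unfolding mat_adjoint_def carrier_mat_def by auto

lemma index_mat_adjoint:
  assumes "A \<in> carrier_mat n m" "i < m" "j < n"
  shows "mat_adjoint A $$ (i, j) = conjugate (A $$ (j, i))"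
  using assms by (auto simp: mat_adjoint_def mat_of_rows_index)

lemma conjugate_hermitian_mult_vec:
  fixes H :: "complex mat"
  assumes H: "H \<in> carrier_mat n n" "mat_adjoint H = H" and w: "w \<in> carrier_vec n"
  shows "conjugate (H *\<^sub>v w) = transpose_mat H *\<^sub>v conjugate w"
proof -
  have sym: "cnj (H $$ (j, i)) = H $$ (i, j)" if "i < n" "j < n" for i j
    using index_mat_adjoint[OF H(1) that] H(2) by (simp add: conjugate_complex_def)
  show ?thesis
    using H(1) w
    by (intro eq_vecI) (auto simp: scalar_prod_def conjugate_complex_def sym)
qed

lemma hermitian_cscalar_prod:
  fixes H :: "complex mat"
  assumes H: "H \<in> carrier_mat n n" "mat_adjoint H = H"
    and v: "v \<in> carrier_vec n" and w: "w \<in> carrier_vec n"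
  shows "v \<bullet>c (H *\<^sub>v w) = (H *\<^sub>v v) \<bullet>c w"
  unfolding conjugate_hermitian_mult_vec[OF H w]
  using transpose_vec_mult_scalar[OF H(1) v, of "conjugate w"] H(1) v w
    comm_scalar_prod[of v n "transpose_mat H *\<^sub>v conjugate w"]
    comm_scalar_prod[of "H *\<^sub>v v" n "conjugate w"]
  by auto

text \<open>One would take for \<open>G\<close> the sum of \<open>H\<close> and the orthogonal projection onto its kernel. It suffices
to add \<open>k k\<^sup>*\<close> for some kernel vector \<open>k\<close> as long as there is one: each addition raises the rank
and changes \<open>H\<close> only by matrices that \<open>H\<close> annihilates.\<close>

lemma hermitian_regularization:
  fixes H :: "complex mat"
  assumes H: "H \<in> carrier_mat n n" "mat_adjoint H = H"
  shows "\<exists>G\<in>carrier_mat n n. H * G = H * H \<and> det G \<noteq> 0"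
proof -
  interpret vec_space "TYPE(complex)" n .
  have "\<exists>G'\<in>carrier_mat n n. H * G' = H * H \<and> det G' \<noteq> 0"
    if "G \<in> carrier_mat n n" "mat_adjoint G = G" "H * G = H * H" for G
    using that
  proof (induction "n - rank G" arbitrary: G rule: less_induct)
    case less
    note G = less.prems
    show ?case
    proof (cases "det G = 0")
      case True
      then obtain k where k: "k \<in> carrier_vec n" "k \<noteq> 0\<^sub>v n" "G *\<^sub>v k = 0\<^sub>v n"
        using det_0_iff_vec_prod_zero[OF G(1)] by auto
      \<comment> \<open>A kernel vector of G is a kernel vector of H, since H G = H H and H is Hermitian;
          hence adding the rank-one matrix k k* keeps the equation H G = H H.\<close>
      have "H *\<^sub>v (H *\<^sub>v k) = (H * G) *\<^sub>v k"
        unfolding G(3) using H k by (simp add: assoc_mult_mat_vec)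
      also have "\<dots> = 0\<^sub>v n"
        using assoc_mult_mat_vec[OF H(1) G(1) k(1)] H(1) k(3) by auto
      finally have HHk: "H *\<^sub>v (H *\<^sub>v k) = 0\<^sub>v n" .
      have Hkc: "H *\<^sub>v k \<in> carrier_vec n" using H k by auto
      have "(H *\<^sub>v k) \<bullet>c (H *\<^sub>v k) = (H *\<^sub>v (H *\<^sub>v k)) \<bullet>c k"
        using hermitian_cscalar_prod[OF H, of "H *\<^sub>v k" k] Hkc k by simp
      hence Hk: "H *\<^sub>v k = 0\<^sub>v n"
        using conjugate_square_eq_0_vec[OF Hkc] k by (simp add: HHk)
      let ?G = "G + outer k (conjugate k)"
      have kk: "k \<bullet>c k \<noteq> 0" using conjugate_square_eq_0_vec[OF k(1)] k(2) by simp
      have Gc: "?G \<in> carrier_mat n n" using G k by auto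
      have sym: "conjugate (G $$ (j, i)) = G $$ (i, j)" if "i < n" "j < n" for i j
        using index_mat_adjoint[OF G(1) that] G(2) by simp
      have tG: "transpose_mat G *\<^sub>v conjugate k = 0\<^sub>v n"
        unfolding conjugate_hermitian_mult_vec[OF G(1,2) k(1), symmetric] k(3)
        by (auto intro!: eq_vecI)
      have "rank ?G = Suc (rank G)"
        by (rule rank_add_outer[where t = "conjugate k" and z = k, OF G(1) _ _ _ _ tG])
           (use k kk in \<open>auto simp: comm_scalar_prod[of "conjugate k" n k]\<close>)
      moreover have "rank ?G \<le> n" using rank_le_nc[OF Gc] .
      moreover have "mat_adjoint ?G = ?G"
        using mat_adjoint_carrier[OF Gc] Gc G k
        by (intro eq_matI)
           (auto simp: index_mat_adjoint[OF Gc] conjugate_complex_def sym[unfolded conjugate_complex_def])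
      moreover have "H * ?G = H * H"
      proof -
        have "H * ?G = H * G + outer (H *\<^sub>v k) (conjugate k)"
          using H G k by (simp add: mult_add_distrib_mat[of _ n n] mult_outer[of _ n n])
        also have "\<dots> = H * H" unfolding G(3) Hk using H k by (intro eq_matI) auto
        finally show ?thesis .
      qed
      ultimately show ?thesis using less.hyps[of ?G] Gc by simp
    qed (use G in auto)
  qed
  from this[of H] H show ?thesis by auto
qed

text \<open>If \<open>H\<close> is invertible this is an eigenvector of \<open>H\<^sup>-\<^sup>1 A\<close>. In general the invertible matrix \<open>G\<close> from
the regularization replaces \<open>H\<close>, and an arbitrary eigenvector of \<open>G\<^sup>-\<^sup>1 A\<close> may lie in the kernel of
\<open>H\<close>. A triangularization of \<open>G\<^sup>-\<^sup>1 A\<close> provides eigenvectors modulo the span of earlier basis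
vectors, and the first basis vector outside the kernel of \<open>H\<close> does the job.\<close>

lemma relative_eigenvector:
  fixes A H :: "complex mat"
  assumes A: "A \<in> carrier_mat n n" "mat_adjoint A = A"
    and H: "H \<in> carrier_mat n n" "mat_adjoint H = H"
    and ker: "\<And>v. v \<in> carrier_vec n \<Longrightarrow> H *\<^sub>v v = 0\<^sub>v n \<Longrightarrow> A *\<^sub>v v = 0\<^sub>v n"
    and H0: "H \<noteq> 0\<^sub>m n n"
  shows "\<exists>x\<in>carrier_vec n. \<exists>\<alpha>. H *\<^sub>v x \<noteq> 0\<^sub>v n \<and> A *\<^sub>v x = \<alpha> \<cdot>\<^sub>v (H *\<^sub>v x)"
proof -
  obtain G where G: "G \<in> carrier_mat n n" "H * G = H * H" "det G \<noteq> 0"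
    using hermitian_regularization[OF H] by auto
  obtain F where F: "F \<in> carrier_mat n n" "G * F = 1\<^sub>m n"
    using det_non_zero_imp_unit[OF G(1,3), of undefined]
    by (auto simp: Units_def ring_mat_def)
  let ?C = "F * A"
  have C: "?C \<in> carrier_mat n n" using F A by auto
  have GC: "G * ?C = A" using assoc_mult_mat[OF G(1) F(1) A(1)] F(2) A by simp
  obtain es where es: "char_poly ?C = (\<Prod>e\<leftarrow>es. [:- e, 1:])"
    using char_poly_factorized[OF C] by auto
  obtain T P Q where "schur_decomposition ?C es = (T, P, Q)"
    by (cases "schur_decomposition ?C es")
  hence sim: "similar_mat_wit ?C T P Q" and T: "upper_triangular T"
    using schur_decomposition[OF C es] by auto
  have car: "T \<in> carrier_mat n n" "P \<in> carrier_mat n n" "Q \<in> carrier_mat n n"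
    and PQ: "P * Q = 1\<^sub>m n" "Q * P = 1\<^sub>m n" and CPT: "?C = P * T * Q"
    using sim C unfolding similar_mat_wit_def Let_def by auto
  have "?C * P = P * T * (Q * P)" unfolding CPT
    using assoc_mult_mat[of "P * T" n n Q n P n] car by auto
  hence CP: "?C * P = P * T" unfolding PQ using car by simp
  \<comment> \<open>The columns of P are a basis that triangularizes C. The first one outside the kernel
      of H is an eigenvector of C modulo that kernel.\<close>
  define X where "X = H * P"
  have X: "X \<in> carrier_mat n n" unfolding X_def using H car by auto
  have "X \<noteq> 0\<^sub>m n n"
  proof
    assume "X = 0\<^sub>m n n"
    hence "H * (P * Q) = 0\<^sub>m n n"
      unfolding X_def using assoc_mult_mat[OF H(1) car(2,3)] car by simp
    thus False using PQ H H0 by simp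
  qed
  hence "\<exists>j<n. col X j \<noteq> 0\<^sub>v n"
  proof (rule contrapos_np)
    assume *: "\<not> (\<exists>j<n. col X j \<noteq> 0\<^sub>v n)"
    show "X = 0\<^sub>m n n"
    proof (rule eq_matI)
      fix i j assume "i < dim_row (0\<^sub>m n n :: complex mat)" "j < dim_col (0\<^sub>m n n :: complex mat)"
      thus "X $$ (i, j) = 0\<^sub>m n n $$ (i, j)"
        using * X index_col[of i X j] by (metis carrier_matD index_zero_mat index_zero_vec(1))
    qed (use X in auto)
  qed
  then obtain j where j: "j < n" "col X j \<noteq> 0\<^sub>v n" and least: "\<And>i. i < j \<Longrightarrow> col X i = 0\<^sub>v n"
    using exists_least_iff[of "\<lambda>j. j < n \<and> col X j \<noteq> 0\<^sub>v n"] by (metis order.strict_trans)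
  define x where "x = col P j"
  define \<alpha> where "\<alpha> = T $$ (j, j)"
  have x: "x \<in> carrier_vec n" using car j unfolding x_def by auto
  have Hx: "H *\<^sub>v x = col X j" unfolding x_def X_def by (rule col_mult2[OF H(1) car(2) j(1), symmetric])
  have "X *\<^sub>v col T j = \<alpha> \<cdot>\<^sub>v col X j"
  proof (rule eq_vecI)
    fix i assume i: "i < dim_vec (\<alpha> \<cdot>\<^sub>v col X j)"
    have "X $$ (i, k) * T $$ (k, j) = (if k = j then X $$ (i, j) * \<alpha> else 0)" if "k < n" for k
    proof (cases k j rule: linorder_cases)
      case less
      have "X $$ (i, k) = 0" using arg_cong[OF least[OF less], of "\<lambda>v. vec_index v i"] i X that by auto
      thus ?thesis using less by simp
    next
      case greater
      thus ?thesis using T that car unfolding upper_triangular_def by auto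
    qed (simp add: \<alpha>_def)
    hence "(X *\<^sub>v col T j) $ i = (\<Sum>k\<in>{0..<n}. if k = j then X $$ (i, j) * \<alpha> else 0)"
      using i j X car by (auto simp: scalar_prod_def intro!: sum.cong)
    thus "(X *\<^sub>v col T j) $ i = (\<alpha> \<cdot>\<^sub>v col X j) $ i" using i j X by simp
  qed (use X in auto)
  also have "X *\<^sub>v col T j = H *\<^sub>v (?C *\<^sub>v x)"
  proof -
    have "X *\<^sub>v col T j = H *\<^sub>v (P *\<^sub>v col T j)"
      unfolding X_def using H car j by (simp add: assoc_mult_mat_vec[of _ n n _ n])
    also have "P *\<^sub>v col T j = ?C *\<^sub>v x"
      unfolding x_def using CP C car j by (metis col_mult2)
    finally show ?thesis .
  qed
  finally have HCx: "H *\<^sub>v (?C *\<^sub>v x) = \<alpha> \<cdot>\<^sub>v (H *\<^sub>v x)" unfolding Hx .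
  \<comment> \<open>The defect v lies in the kernels of H and of A, and it is a combination of vectors in
      their ranges, which are orthogonal to those kernels. So v is orthogonal to itself.\<close>
  define v where "v = A *\<^sub>v x - \<alpha> \<cdot>\<^sub>v (H *\<^sub>v x)"
  have vc: "v \<in> carrier_vec n" unfolding v_def using A H x by auto
  have Ax: "A *\<^sub>v x = G *\<^sub>v (?C *\<^sub>v x)"
    using GC assoc_mult_mat_vec[OF G(1) C x] by simp
  have "H *\<^sub>v (A *\<^sub>v x) = (H * G) *\<^sub>v (?C *\<^sub>v x)"
    unfolding Ax by (rule assoc_mult_mat_vec[OF H(1) G(1), symmetric]) (use C x in auto)
  also have "\<dots> = H *\<^sub>v (\<alpha> \<cdot>\<^sub>v (H *\<^sub>v x))"
    unfolding G(2) HCx[symmetric] by (rule assoc_mult_mat_vec[OF H(1) H(1)]) (use C x in auto)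
  finally have Hv: "H *\<^sub>v v = 0\<^sub>v n"
    unfolding v_def using A H x by (simp add: mult_minus_distrib_mat_vec[of _ n n])
  have Av: "A *\<^sub>v v = 0\<^sub>v n" by (rule ker[OF vc Hv])
  have "v \<bullet>c v = (A *\<^sub>v x) \<bullet>c v - (\<alpha> \<cdot>\<^sub>v (H *\<^sub>v x)) \<bullet>c v"
    unfolding v_def[symmetric] by (subst (1) v_def, rule minus_scalar_prod_distrib[of _ n]) (use A H x vc in auto)
  also have "\<dots> = x \<bullet>c (A *\<^sub>v v) - \<alpha> * (x \<bullet>c (H *\<^sub>v v))"
    using hermitian_cscalar_prod[OF A x vc] hermitian_cscalar_prod[OF H x vc] H x vc by simp
  also have "\<dots> = 0" unfolding Av Hv using x by simp
  finally have "v = 0\<^sub>v n" using conjugate_square_eq_0_vec[OF vc] by simp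
  hence "A *\<^sub>v x = \<alpha> \<cdot>\<^sub>v (H *\<^sub>v x)"
  proof -
    assume "v = 0\<^sub>v n"
    have "A *\<^sub>v x = v + \<alpha> \<cdot>\<^sub>v (H *\<^sub>v x)"
      unfolding v_def using A H x by (intro eq_vecI) auto
    thus ?thesis using \<open>v = 0\<^sub>v n\<close> H x by simp
  qed
  thus ?thesis using x j(2) Hx by (metis (no_types))
qed

text \<open>The parallel images \<open>c y\<close> and \<open>d y\<close> treat finite and infinite eigenvalues of the pencil alike. The
condition that they do not both vanish excludes the common kernel of \<open>A\<close> and \<open>H\<close>, where nothing
could be split off.\<close>

lemma hermitian_pair_eigenvector:
  fixes A H :: "complex mat"
  assumes A: "A \<in> carrier_mat n n" "mat_adjoint A = A"
    and H: "H \<in> carrier_mat n n" "mat_adjoint H = H"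
    and nz: "A \<noteq> 0\<^sub>m n n \<or> H \<noteq> 0\<^sub>m n n"
  obtains x y c d where "x \<in> carrier_vec n" "y \<in> carrier_vec n" "y \<noteq> 0\<^sub>v n"
    "c \<noteq> 0 \<or> d \<noteq> 0" "A *\<^sub>v x = c \<cdot>\<^sub>v y" "H *\<^sub>v x = d \<cdot>\<^sub>v y"
proof (cases "\<exists>v\<in>carrier_vec n. H *\<^sub>v v = 0\<^sub>v n \<and> A *\<^sub>v v \<noteq> 0\<^sub>v n")
  case True
  then obtain v where "v \<in> carrier_vec n" "H *\<^sub>v v = 0\<^sub>v n" "A *\<^sub>v v \<noteq> 0\<^sub>v n" by auto
  thus ?thesis using A by (intro that[of v "A *\<^sub>v v" 1 0]) auto
next
  case False
  have "H \<noteq> 0\<^sub>m n n"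
  proof
    assume H0: "H = 0\<^sub>m n n"
    have "A *\<^sub>v unit_vec n j = 0\<^sub>v n" if "j < n" for j
    proof -
      have "0\<^sub>m n n *\<^sub>v unit_vec n j = (0\<^sub>v n :: complex vec)" by (intro eq_vecI) auto
      thus ?thesis using False unit_vec_carrier[of n j] unfolding H0 by blast
    qed
    hence "col A j = 0\<^sub>v n" if "j < n" for j
      using that A by (intro eq_vecI) (force simp: vec_eq_iff)+
    hence "A = 0\<^sub>m n n" using A by (intro mat_col_eqI) auto
    thus False using H0 nz by simp
  qed
  then obtain x \<alpha> where "x \<in> carrier_vec n" "H *\<^sub>v x \<noteq> 0\<^sub>v n" "A *\<^sub>v x = \<alpha> \<cdot>\<^sub>v (H *\<^sub>v x)"
    using relative_eigenvector[OF A H] False by auto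
  thus ?thesis using H by (intro that[of x "H *\<^sub>v x" \<alpha> 1]) auto
qed

section \<open>Rank-one updates of polynomial matrices\<close>

lemma mult_add_outer_vec:
  fixes M :: "'a::comm_ring_1 mat"
  assumes "M \<in> carrier_mat n m" "a \<in> carrier_vec n" "b \<in> carrier_vec m" "g \<in> carrier_vec m"
  shows "(M + outer a b) *\<^sub>v g = M *\<^sub>v g + (b \<bullet> g) \<cdot>\<^sub>v a"
  using assms by (subst add_mult_distrib_mat_vec[of _ n m]) (auto simp: outer_mult_vec)

lemma transpose_outer:
  fixes a b :: "'a::comm_semiring_0 vec"
  shows "transpose_mat (outer a b) = outer b a"
  by (intro eq_matI) (auto simp: mult.commute)

lemma (in semiring_hom) scalar_prod_hom:
  "dim_vec v = dim_vec w \<Longrightarrow> hom (v \<bullet> w) = map_vec hom v \<bullet> map_vec hom w"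
  by (simp add: scalar_prod_def hom_sum hom_mult)

lemma normal_rank_add_outer:
  assumes M: "M \<in> carrier_mat n n" and a: "a \<in> carrier_vec n" and b: "b \<in> carrier_vec n"
    and t: "t \<in> carrier_vec n" and z: "z \<in> carrier_vec n"
    and tM: "transpose_mat M *\<^sub>v t = 0\<^sub>v n" and ta: "t \<bullet> a \<noteq> 0"
    and Mz: "M *\<^sub>v z = 0\<^sub>v n" and bz: "b \<bullet> z \<noteq> 0"
  shows "normal_rank (M + outer a b) = Suc (normal_rank M)"
proof -
  interpret f: inj_idom_hom "to_fract :: complex poly \<Rightarrow> _"
    by unfold_locales auto
  interpret vec_space "TYPE(complex poly fract)" n .
  have hom: "map_mat to_fract (M + outer a b)
      = map_mat to_fract M + outer (map_vec to_fract a) (map_vec to_fract b)"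
    using M a b by (intro eq_matI) (auto simp: f.hom_add f.hom_mult)
  have "rank (map_mat to_fract M + outer (map_vec to_fract a) (map_vec to_fract b))
      = Suc (rank (map_mat to_fract M))"
  proof (rule rank_add_outer[where t = "map_vec to_fract t" and z = "map_vec to_fract z"])
    show "transpose_mat (map_mat to_fract M) *\<^sub>v map_vec to_fract t = 0\<^sub>v n"
      using f.mult_mat_vec_hom[of "transpose_mat M" n n t] M t tM
      by (simp add: map_mat_transpose f.vec_hom_zero)
    show "map_mat to_fract M *\<^sub>v map_vec to_fract z = 0\<^sub>v n"
      using f.mult_mat_vec_hom[OF M z] Mz by (simp add: f.vec_hom_zero)
    show "map_vec to_fract t \<bullet> map_vec to_fract a \<noteq> 0"
      using f.scalar_prod_hom[of t a, symmetric] t a ta by (metis carrier_vecD to_fract_eq_0_iff)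
    show "map_vec to_fract b \<bullet> map_vec to_fract z \<noteq> 0"
      using f.scalar_prod_hom[of b z, symmetric] b z bz by (metis carrier_vecD to_fract_eq_0_iff)
  qed (use M a b t z in auto)
  thus ?thesis unfolding normal_rank_def hom using M a by simp
qed

section \<open>Para-Hermitian pencils\<close>

text \<open>Conjugation of the coefficients followed by the substitution of \<open>-\<lambda>\<close> for \<open>\<lambda>\<close>: on the imaginary
axis this is pointwise complex conjugation. A pencil is \<open>*\<close>-even iff it is Hermitian with respect
to this involution, so the Hermitian algebra carries over to polynomial entries.\<close>

definition para_conj :: "complex poly \<Rightarrow> complex poly" where
  "para_conj p = pcompose (map_poly cnj p) [:0, -1:]"

lemma coeff_para_conj: "coeff (para_conj p) k = (-1) ^ k * cnj (coeff p k)"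
  by (simp add: para_conj_def coeff_pcompose_linear coeff_map_poly)

interpretation para_conj: comm_ring_hom para_conj
proof
  fix p q :: "complex poly"
  show "para_conj (p * q) = para_conj p * para_conj q"
  proof (rule poly_eqI)
    fix k
    have "(-1) ^ k * cnj (coeff p i * coeff q (k - i))
        = coeff (para_conj p) i * coeff (para_conj q) (k - i)" if "i \<le> k" for i
    proof -
      have "(-1 :: complex) ^ k = (-1) ^ i * (-1) ^ (k - i)"
        using that by (simp flip: power_add)
      thus ?thesis by (simp add: coeff_para_conj)
    qed
    hence "(\<Sum>i\<le>k. (-1) ^ k * cnj (coeff p i * coeff q (k - i)))
        = (\<Sum>i\<le>k. coeff (para_conj p) i * coeff (para_conj q) (k - i))"
      by (intro sum.cong refl) auto
    thus "coeff (para_conj (p * q)) k = coeff (para_conj p * para_conj q) k"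
      by (simp only: coeff_para_conj coeff_mult cnj_sum sum_distrib_left)
  qed
  show "para_conj 1 = 1"
    by (rule poly_eqI) (simp add: coeff_para_conj coeff_1)
qed (auto intro!: poly_eqI simp: coeff_para_conj algebra_simps)

lemma para_conj_para_conj [simp]: "para_conj (para_conj p) = p"
  by (rule poly_eqI) (simp add: coeff_para_conj flip: mult.assoc power_add mult_2)

lemma para_conj_eq_0_iff [simp]: "para_conj p = 0 \<longleftrightarrow> p = 0"
  by (metis para_conj_para_conj para_conj.hom_zero)

lemma para_conj_const [simp]: "para_conj [:c:] = [:cnj c:]"
  by (rule poly_eqI) (simp add: coeff_para_conj coeff_pCons split: nat.split)

lemma degree_para_conj [simp]: "degree (para_conj p) = degree p"
proof -
  have "degree (para_conj q) \<le> degree q" for q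
    by (rule degree_le) (simp add: coeff_para_conj coeff_eq_0)
  from this[of p] this[of "para_conj p"] show ?thesis by simp
qed

abbreviation para_conj_vec :: "complex poly vec \<Rightarrow> complex poly vec" where
  "para_conj_vec \<equiv> map_vec para_conj"

abbreviation const_vec :: "complex vec \<Rightarrow> complex poly vec" where
  "const_vec \<equiv> map_vec (\<lambda>c. [:c:])"

lemma para_conj_vec_const: "para_conj_vec (const_vec x) = const_vec (conjugate x)"
  by (intro eq_vecI) (auto simp: conjugate_complex_def)

lemma para_conj_vec_para_conj_vec [simp]: "para_conj_vec (para_conj_vec v) = v"
  by (intro eq_vecI) auto

lemma scalar_prod_const_vec:
  "dim_vec x = dim_vec y \<Longrightarrow> const_vec x \<bullet> const_vec y = [:x \<bullet> y:]"
  by (intro poly_eqI) (simp add: scalar_prod_def coeff_sum coeff_pCons mult.commute split: nat.split)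

definition para_hermitian_pencil :: "nat \<Rightarrow> complex poly mat \<Rightarrow> bool" where
  "para_hermitian_pencil n E \<longleftrightarrow> E \<in> carrier_mat n n \<and>
     (\<forall>i<n. \<forall>j<n. para_conj (E $$ (i, j)) = E $$ (j, i) \<and> degree (E $$ (i, j)) \<le> 1)"

lemma star_even_pencil_imp_para_hermitian:
  assumes "star_even_pencil n E"
  shows "para_hermitian_pencil n E"
proof -
  obtain A B where A: "A \<in> carrier_mat n n" "mat_adjoint A = A"
    and B: "B \<in> carrier_mat n n" "mat_adjoint B = - B" and E: "E = pencil A B"
    using assms unfolding star_even_pencil_def by auto
  have Eij: "E $$ (i, j) = [:A $$ (i, j), B $$ (i, j):]" if "i < n" "j < n" for i j
    using that A B by (simp add: E pencil_def)
  have "cnj (A $$ (i, j)) = A $$ (j, i)" "- cnj (B $$ (i, j)) = B $$ (j, i)"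
    if "i < n" "j < n" for i j
    using index_mat_adjoint[OF A(1) that(2,1)] index_mat_adjoint[OF B(1) that(2,1)] A B that
    by (simp_all add: conjugate_complex_def minus_equation_iff)
  moreover have "para_conj [:a, b:] = [:cnj a, - cnj b:]" for a b
    by (rule poly_eqI) (auto simp: coeff_para_conj coeff_pCons split: nat.split)
  ultimately show ?thesis
    using A B unfolding para_hermitian_pencil_def by (auto simp: Eij E pencil_def)
qed

text \<open>The two coefficients, made Hermitian, map \<open>x\<close> to multiples of a common vector \<open>y\<close>, so the pencil
maps it to a polynomial multiple of \<open>y\<close>.\<close>

lemma para_hermitian_pencil_eigenvector:
  assumes E: "para_hermitian_pencil n E" and nz: "E \<noteq> 0\<^sub>m n n"
  obtains x y p where "x \<in> carrier_vec n" "y \<in> carrier_vec n" "y \<noteq> 0\<^sub>v n"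
    "p \<noteq> 0" "degree p \<le> 1" "E *\<^sub>v const_vec x = p \<cdot>\<^sub>v const_vec y"
proof -
  have Ec: "E \<in> carrier_mat n n" and deg: "\<And>i j. i < n \<Longrightarrow> j < n \<Longrightarrow> degree (E $$ (i, j)) \<le> 1"
    and sym: "\<And>i j. i < n \<Longrightarrow> j < n \<Longrightarrow> para_conj (E $$ (i, j)) = E $$ (j, i)"
    using E by (auto simp: para_hermitian_pencil_def)
  \<comment> \<open>The coefficient of the indeterminate is skew-Hermitian; the factor i makes it Hermitian.\<close>
  define A where "A = map_mat (\<lambda>p. coeff p 0) E"
  define H where "H = map_mat (\<lambda>p. \<i> * coeff p 1) E"
  have car: "A \<in> carrier_mat n n" "H \<in> carrier_mat n n"
    unfolding A_def H_def using Ec by auto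
  have A: "mat_adjoint A = A"
  proof (rule eq_matI)
    fix i j assume "i < dim_row A" "j < dim_col A"
    hence ij: "i < n" "j < n" using car by auto
    show "mat_adjoint A $$ (i, j) = A $$ (i, j)"
      using index_mat_adjoint[OF car(1) ij] arg_cong[OF sym[OF ij(2,1)], of "\<lambda>p. coeff p 0"] ij Ec
      by (simp add: A_def conjugate_complex_def coeff_para_conj)
  qed (use car mat_adjoint_carrier[OF car(1)] in auto)
  have H: "mat_adjoint H = H"
  proof (rule eq_matI)
    fix i j assume "i < dim_row H" "j < dim_col H"
    hence ij: "i < n" "j < n" using car by auto
    show "mat_adjoint H $$ (i, j) = H $$ (i, j)"
      using index_mat_adjoint[OF car(2) ij] arg_cong[OF sym[OF ij(2,1)], of "\<lambda>p. coeff p 1"] ij Ec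
      by (simp add: H_def conjugate_complex_def coeff_para_conj) (metis mult_minus_right)
  qed (use car mat_adjoint_carrier[OF car(2)] in auto)
  have poly1: "p = [:coeff p 0, coeff p 1:]" if "degree p \<le> 1" for p :: "complex poly"
    using that by (intro poly_eqI) (auto simp: coeff_pCons coeff_eq_0 split: nat.split)
  have "A \<noteq> 0\<^sub>m n n \<or> H \<noteq> 0\<^sub>m n n"
  proof (rule ccontr)
    assume "\<not> ?thesis"
    hence *: "A = 0\<^sub>m n n" "H = 0\<^sub>m n n" by auto
    have "E $$ (i, j) = 0" if "i < n" "j < n" for i j
    proof -
      have "A $$ (i, j) = 0" "H $$ (i, j) = 0" using that by (simp_all add: *)
      thus ?thesis using poly1[OF deg[OF that]] that Ec by (simp add: A_def H_def)
    qed
    hence "E = 0\<^sub>m n n" using Ec by (intro eq_matI) auto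
    thus False using nz by simp
  qed
  then obtain x y c d where xy: "x \<in> carrier_vec n" "y \<in> carrier_vec n" "y \<noteq> 0\<^sub>v n"
    "c \<noteq> 0 \<or> d \<noteq> 0" "A *\<^sub>v x = c \<cdot>\<^sub>v y" "H *\<^sub>v x = d \<cdot>\<^sub>v y"
    using hermitian_pair_eigenvector[OF car(1) A car(2) H] by blast
  have "E *\<^sub>v const_vec x = [:c, - \<i> * d:] \<cdot>\<^sub>v const_vec y"
  proof (rule eq_vecI)
    fix i assume "i < dim_vec ([:c, - \<i> * d:] \<cdot>\<^sub>v const_vec y)"
    hence i: "i < n" using xy by simp
    have "(\<Sum>j<n. A $$ (i, j) * x $ j) = c * y $ i" "(\<Sum>j<n. H $$ (i, j) * x $ j) = d * y $ i"
      using arg_cong[OF xy(5), of "\<lambda>v. vec_index v i"] arg_cong[OF xy(6), of "\<lambda>v. vec_index v i"]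
        i car xy(1,2) by (simp_all add: scalar_prod_def atLeast0LessThan)
    hence sums: "(\<Sum>j<n. coeff (E $$ (i, j)) 0 * x $ j) = c * y $ i"
      "(\<Sum>j<n. \<i> * coeff (E $$ (i, j)) 1 * x $ j) = d * y $ i"
      using i Ec by (simp_all add: A_def H_def)
    have "\<i> * (\<Sum>j<n. coeff (E $$ (i, j)) 1 * x $ j) = d * y $ i"
      unfolding sums(2)[symmetric] by (simp add: sum_distrib_left mult.assoc)
    hence "\<i> * (\<i> * (\<Sum>j<n. coeff (E $$ (i, j)) 1 * x $ j)) = \<i> * (d * y $ i)" by simp
    hence sum1: "(\<Sum>j<n. coeff (E $$ (i, j)) 1 * x $ j) = - \<i> * d * y $ i"
      by (simp add: algebra_simps neg_eq_iff_add_eq_0 eq_neg_iff_add_eq_0)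
    have "(\<Sum>j<n. E $$ (i, j) * [:x $ j:]) = [:c, - \<i> * d:] * [:y $ i:]"
    proof (rule poly_eqI)
      fix k
      have "coeff (\<Sum>j<n. E $$ (i, j) * [:x $ j:]) k = (\<Sum>j<n. coeff (E $$ (i, j)) k * x $ j)"
        by (simp add: coeff_sum mult.commute)
      also have "\<dots> = coeff ([:c, - \<i> * d:] * [:y $ i:]) k"
      proof (cases "k \<le> 1")
        case True
        then consider "k = 0" | "k = 1" by linarith
        thus ?thesis using sums(1) sum1 by cases (simp_all add: mult.commute)
      next
        case False
        hence "coeff (E $$ (i, j)) k = 0" if "j < n" for j
          using deg[OF i that] by (intro coeff_eq_0) simp
        thus ?thesis using False by (auto simp: coeff_pCons split: nat.split)
      qed
      finally show "coeff (\<Sum>j<n. E $$ (i, j) * [:x $ j:]) k = coeff ([:c, - \<i> * d:] * [:y $ i:]) k" .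
    qed
    thus "(E *\<^sub>v const_vec x) $ i = ([:c, - \<i> * d:] \<cdot>\<^sub>v const_vec y) $ i"
      using i Ec xy by (simp add: scalar_prod_def atLeast0LessThan)
  qed (use Ec xy in auto)
  thus ?thesis using xy by (intro that[of x y "[:c, - \<i> * d:]"]) auto
qed

lemma para_conj_vec_mult:
  assumes E: "para_hermitian_pencil n E" and f: "f \<in> carrier_vec n"
  shows "para_conj_vec (E *\<^sub>v f) = transpose_mat E *\<^sub>v para_conj_vec f"
proof -
  have Ec: "E \<in> carrier_mat n n" and "map_mat para_conj E = transpose_mat E"
    using E unfolding para_hermitian_pencil_def by (auto intro!: eq_matI)
  thus ?thesis using para_conj.mult_mat_vec_hom[OF Ec f] by simp
qed

text \<open>Self-adjointness of the pencil for the form \<open>f\<^sup>* g\<close>, where the star is the para-conjugate transpose.\<close>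

lemma para_hermitian_scalar_prod:
  assumes E: "para_hermitian_pencil n E" and f: "f \<in> carrier_vec n" and g: "g \<in> carrier_vec n"
  shows "para_conj_vec (E *\<^sub>v f) \<bullet> g = para_conj_vec f \<bullet> (E *\<^sub>v g)"
  unfolding para_conj_vec_mult[OF E f]
  using E f g unfolding para_hermitian_pencil_def
  by (intro transpose_vec_mult_scalar) auto

section \<open>Splitting off terms at an eigenvector\<close>

lemma mult_mat_smult_vec:
  fixes M :: "'a::comm_semiring_0 mat"
  assumes "dim_vec v = dim_col M"
  shows "M *\<^sub>v (c \<cdot>\<^sub>v v) = c \<cdot>\<^sub>v (M *\<^sub>v v)"
  using assms by (intro eq_vecI) (auto simp: scalar_prod_def sum_distrib_left ac_simps)

lemma mult_star_const:
  "mult_star v (const_vec u) = outer v (para_conj_vec (const_vec u))"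
  by (intro eq_matI) (auto simp: mult_star_def map_poly_pCons)

text \<open>The product defining \<open>mult_star\<close> conjugates coefficients without reflecting \<open>\<lambda>\<close>. Reflecting the
second factor beforehand turns this into the para-conjugate transpose.\<close>

lemma mult_star_reflect_vec:
  "mult_star v (reflect_vec w) = outer v (para_conj_vec w)"
  by (intro eq_matI)
     (auto simp: mult_star_def reflect_vec_def coeff_para_conj coeff_pcompose_linear coeff_map_poly
       intro!: arg_cong[where f = "\<lambda>p. _ * p"] poly_eqI)

lemma reflect_vec_reflect_vec: "reflect_vec (reflect_vec w) = w"
proof -
  have "pcompose (pcompose p [:0, -1:]) [:0, -1:] = p" for p :: "complex poly"
    by (rule poly_eqI) (simp add: coeff_pcompose_linear flip: mult.assoc power_add mult_2)
  thus ?thesis by (intro eq_vecI) (simp_all add: reflect_vec_def)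
qed

lemma vec_degree_le:
  assumes "\<And>i. i < dim_vec w \<Longrightarrow> degree (w $ i) \<le> d"
  shows "vec_degree w \<le> d"
  using assms by (auto simp: vec_degree_def vec_set_def)

lemma para_hermitian_left_kernel:
  assumes E: "para_hermitian_pencil n E" and x: "x \<in> carrier_vec n" "E *\<^sub>v x = 0\<^sub>v n"
  shows "transpose_mat E *\<^sub>v para_conj_vec x = 0\<^sub>v n"
  unfolding para_conj_vec_mult[OF E x(1), symmetric] x(2)
  by (rule para_conj.vec_hom_zero)

text \<open>With \<open>x\<^sup>* u = 1\<close> and \<open>E x = q u\<close>, the matrix \<open>q u u\<^sup>*\<close> agrees with \<open>E\<close> on \<open>x\<close>, so the difference
annihilates \<open>x\<close> and has rank one less. The factor \<open>q\<close> has the form \<open>a + \<lambda> b \<i>\<close> since it is the value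
\<open>x\<^sup>* E x\<close> of the Hermitian form.\<close>

lemma para_hermitian_split_nonisotropic:
  assumes E: "para_hermitian_pencil n E"
    and x: "x \<in> carrier_vec n" and y: "y \<in> carrier_vec n"
    and Ex: "E *\<^sub>v const_vec x = p \<cdot>\<^sub>v const_vec y" and p: "p \<noteq> 0" "degree p \<le> 1"
    and nz: "y \<bullet>c x \<noteq> 0"
  obtains E' u a b where "para_hermitian_pencil n E'" "u \<in> carrier_vec n"
    "E = E' + [:complex_of_real a, complex_of_real b * \<i>:] \<cdot>\<^sub>m mult_star (const_vec u) (const_vec u)"
    "normal_rank E = Suc (normal_rank E')"
proof -
  define s where "s = y \<bullet>c x"
  define u where "u = (1 / s) \<cdot>\<^sub>v y"
  \<comment> \<open>The scaling makes x* u = 1, and then q = x* E x is fixed by para-conjugation.\<close>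
  define q where "q = Polynomial.smult s p"
  define X where "X = const_vec x"
  define U where "U = const_vec u"
  have Ec: "E \<in> carrier_mat n n" using E by (simp add: para_hermitian_pencil_def)
  have u: "u \<in> carrier_vec n" using y by (simp add: u_def)
  have XU: "X \<in> carrier_vec n" "U \<in> carrier_vec n" using x u by (auto simp: X_def U_def)
  have q0: "q \<noteq> 0" using p nz by (simp add: q_def s_def)
  have EX: "E *\<^sub>v X = q \<cdot>\<^sub>v U"
    unfolding X_def Ex U_def u_def q_def using nz y by (intro eq_vecI) (auto simp: s_def)
  have X'U: "para_conj_vec X \<bullet> U = 1"
  proof -
    have "conjugate x \<bullet> u = 1"
      using comm_scalar_prod[of "conjugate x" n y] nz x y by (simp add: u_def s_def)
    thus ?thesis unfolding X_def U_def para_conj_vec_const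
      using scalar_prod_const_vec[of "conjugate x" u] x u by (simp add: one_pCons)
  qed
  have U'X: "para_conj_vec U \<bullet> X = 1"
    using arg_cong[OF X'U, of para_conj] XU comm_scalar_prod[of X n "para_conj_vec U"]
    by (simp add: para_conj.scalar_prod_hom)
  have X'EX: "para_conj_vec X \<bullet> (E *\<^sub>v X) = q" unfolding EX using XU X'U by simp
  have q: "para_conj q = q"
  proof -
    have "para_conj q = X \<bullet> para_conj_vec (E *\<^sub>v X)"
      unfolding X'EX[symmetric] using XU Ec by (subst para_conj.scalar_prod_hom) auto
    also have "\<dots> = para_conj_vec (E *\<^sub>v X) \<bullet> X"
      using XU Ec by (intro comm_scalar_prod[of _ n]) auto
    also have "\<dots> = q" using para_hermitian_scalar_prod[OF E XU(1) XU(1)] X'EX by simp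
    finally show ?thesis .
  qed
  have q_eq: "q = [:complex_of_real (Re (coeff q 0)), complex_of_real (Im (coeff q 1)) * \<i>:]"
  proof (rule poly_eqI)
    fix k
    have "cnj (coeff q 0) = coeff q 0" "- cnj (coeff q 1) = coeff q 1"
      using arg_cong[OF q, of "\<lambda>p. coeff p 0"] arg_cong[OF q, of "\<lambda>p. coeff p 1"]
      by (simp_all add: coeff_para_conj)
    moreover have "coeff q k = 0" if "k > 1" using that p(2) by (simp add: q_def coeff_eq_0)
    ultimately show "coeff q k
        = coeff [:complex_of_real (Re (coeff q 0)), complex_of_real (Im (coeff q 1)) * \<i>:] k"
      by (auto simp: coeff_pCons complex_eq_iff split: nat.split)
  qed
  define E' where "E' = E - outer (q \<cdot>\<^sub>v U) (para_conj_vec U)"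
  have E'c: "E' \<in> carrier_mat n n" using Ec XU by (auto simp: E'_def)
  have E'E: "E = E' + outer (q \<cdot>\<^sub>v U) (para_conj_vec U)"
    using Ec XU by (intro eq_matI) (auto simp: E'_def)
  have E': "para_hermitian_pencil n E'"
    unfolding para_hermitian_pencil_def
  proof (intro conjI allI impI E'c)
    fix i j assume ij: "i < n" "j < n"
    have ent: "E' $$ (i, j) = E $$ (i, j) - q * U $ i * para_conj (U $ j)" if "i < n" "j < n" for i j
      using that Ec XU by (simp add: E'_def)
    show "para_conj (E' $$ (i, j)) = E' $$ (j, i)"
      using ij E by (simp add: ent para_hermitian_pencil_def para_conj.hom_minus para_conj.hom_mult q mult_ac)
    have "degree (q * U $ i * para_conj (U $ j)) \<le> 1"
      using ij u p(2) by (simp add: U_def q_def)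
    thus "degree (E' $$ (i, j)) \<le> 1"
      unfolding ent[OF ij] using E ij by (intro degree_diff_le) (auto simp: para_hermitian_pencil_def)
  qed
  have E'X: "E' *\<^sub>v X = 0\<^sub>v n"
  proof -
    have "E *\<^sub>v X = E' *\<^sub>v X + q \<cdot>\<^sub>v U"
      unfolding E'E using mult_add_outer_vec[OF E'c, of "q \<cdot>\<^sub>v U" "para_conj_vec U" X] XU U'X by simp
    hence "E' *\<^sub>v X = E *\<^sub>v X - q \<cdot>\<^sub>v U" using E'c Ec XU by (intro eq_vecI) auto
    thus ?thesis unfolding EX using XU by simp
  qed
  have "normal_rank E = Suc (normal_rank E')"
    unfolding E'E
  proof (rule normal_rank_add_outer[where t = "para_conj_vec X" and z = X, OF E'c])
    show "transpose_mat E' *\<^sub>v para_conj_vec X = 0\<^sub>v n"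
      by (rule para_hermitian_left_kernel[OF E' XU(1) E'X])
  qed (use XU E'X U'X X'U q0 in auto)
  moreover have "outer (q \<cdot>\<^sub>v U) (para_conj_vec U) = q \<cdot>\<^sub>m mult_star U U"
    unfolding U_def mult_star_const by (intro eq_matI) auto
  hence "E = E' + [:complex_of_real (Re (coeff q 0)), complex_of_real (Im (coeff q 1)) * \<i>:]
      \<cdot>\<^sub>m mult_star (const_vec u) (const_vec u)"
    using E'E unfolding q_eq[symmetric] by (simp add: U_def)
  ultimately show thesis using E' u by (intro that)
qed

text \<open>Here \<open>x\<^sup>* E x = 0\<close>, and no multiple of \<open>y y\<^sup>*\<close> can reproduce \<open>E\<close> on \<open>x\<close>. For \<open>z\<close> with \<open>y\<^sup>* z = 1\<close> there is
a polynomial vector \<open>W\<close> such that \<open>y W\<^sup>* + W y\<^sup>*\<close> agrees with \<open>E\<close> on both \<open>x\<close> and \<open>z\<close>. The difference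
annihilates the two vectors, and the two outer products raise its rank by one each. The vector
\<open>W\<close> enters the decomposition reflected.\<close>

lemma para_hermitian_split_isotropic:
  assumes E: "para_hermitian_pencil n E"
    and x: "x \<in> carrier_vec n" and y: "y \<in> carrier_vec n" "y \<noteq> 0\<^sub>v n"
    and Ex: "E *\<^sub>v const_vec x = p \<cdot>\<^sub>v const_vec y" and p: "p \<noteq> 0"
    and iso: "y \<bullet>c x = 0"
  obtains E' v w where "para_hermitian_pencil n E'" "v \<in> carrier_vec n" "w \<in> carrier_vec n"
    "vec_degree w \<le> 1"
    "E = E' + mult_star (const_vec v) w + mult_star (reflect_vec w) (const_vec v)"
    "normal_rank E = normal_rank E' + 2"
proof -
  have Ec: "E \<in> carrier_mat n n" using E by (simp add: para_hermitian_pencil_def)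
  define z where "z = (1 / (y \<bullet>c y)) \<cdot>\<^sub>v y"
  define X where "X = const_vec x"
  define Y where "Y = const_vec y"
  define Z where "Z = const_vec z"
  have z: "z \<in> carrier_vec n" using y by (simp add: z_def)
  have car: "X \<in> carrier_vec n" "Y \<in> carrier_vec n" "Z \<in> carrier_vec n"
    using x y z by (auto simp: X_def Y_def Z_def)
  have EX: "E *\<^sub>v X = p \<cdot>\<^sub>v Y" unfolding X_def Y_def by (rule Ex)
  have X'Y: "para_conj_vec X \<bullet> Y = 0"
    using comm_scalar_prod[of "conjugate x" n y] iso x y scalar_prod_const_vec[of "conjugate x" y]
    by (simp add: X_def Y_def para_conj_vec_const)
  have Y'Z: "para_conj_vec Y \<bullet> Z = 1"
  proof -
    have "conjugate y \<bullet> z = 1"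
      using comm_scalar_prod[of "conjugate y" n y] y conjugate_square_eq_0_vec[OF y(1)]
      by (simp add: z_def)
    thus ?thesis unfolding Y_def Z_def para_conj_vec_const
      using scalar_prod_const_vec[of "conjugate y" z] y z by (simp add: one_pCons)
  qed
  \<comment> \<open>Pairings of the form f* g are conjugated by exchanging f and g.\<close>
  have swap: "para_conj (para_conj_vec f \<bullet> g) = para_conj_vec g \<bullet> f"
    if "f \<in> carrier_vec n" "g \<in> carrier_vec n" for f g
    using that comm_scalar_prod[of f n "para_conj_vec g"] by (simp add: para_conj.scalar_prod_hom)
  have Y'X: "para_conj_vec Y \<bullet> X = 0" using swap[OF car(1,2)] X'Y by simp
  have Z'Y: "para_conj_vec Z \<bullet> Y = 1" using swap[OF car(2,3)] Y'Z by simp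
  \<comment> \<open>The vector W is the solution of E Z = Y (W* Z) + W (Y* Z), the condition that the two
      outer products reproduce E on Z. Pairing that equation with Z shows that W* Z and its
      conjugate add up to Z* E Z, and W* Z is chosen as half of it.\<close>
  define e where "e = para_conj_vec Z \<bullet> (E *\<^sub>v Z)"
  define c where "c = Polynomial.smult (1 / 2) e"
  have EZ: "E *\<^sub>v Z \<in> carrier_vec n" using Ec car by simp
  have e: "para_conj e = e"
    unfolding e_def using swap[OF car(3) EZ] para_hermitian_scalar_prod[OF E car(3) car(3)] by simp
  have c: "para_conj c = c"
    by (rule poly_eqI, use arg_cong[OF e, of "\<lambda>p. coeff p k" for k] in \<open>simp add: c_def coeff_para_conj\<close>)
  have cc: "c + c = e"
    by (simp add: c_def flip: smult_add_left)
  define W where "W = E *\<^sub>v Z - c \<cdot>\<^sub>v Y"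
  have W: "W \<in> carrier_vec n" using EZ car by (simp add: W_def)
  have W': "para_conj_vec W = para_conj_vec (E *\<^sub>v Z) - c \<cdot>\<^sub>v para_conj_vec Y"
    unfolding W_def using Ec EZ car by (intro eq_vecI) (auto simp: para_conj.hom_minus para_conj.hom_mult c)
  have W'dot: "para_conj_vec W \<bullet> f = para_conj_vec Z \<bullet> (E *\<^sub>v f) - c * (para_conj_vec Y \<bullet> f)"
    if "f \<in> carrier_vec n" for f
    unfolding W' using that car EZ para_hermitian_scalar_prod[OF E car(3) that]
    by (simp add: minus_scalar_prod_distrib[of _ n])
  have W'X: "para_conj_vec W \<bullet> X = p"
    unfolding W'dot[OF car(1)] EX using Y'X Z'Y car by simp
  have W'Z: "para_conj_vec W \<bullet> Z = c"
    unfolding W'dot[OF car(3)] Y'Z e_def[symmetric] using cc by (simp add: algebra_simps)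
  have X'W: "para_conj_vec X \<bullet> W \<noteq> 0" using swap[OF W car(1)] W'X p by auto
  define E' where "E' = E - (outer W (para_conj_vec Y) + outer Y (para_conj_vec W))"
  have E'c: "E' \<in> carrier_mat n n" using Ec car W by (auto simp: E'_def)
  define D where "D = E' + outer W (para_conj_vec Y)"
  have Dc: "D \<in> carrier_mat n n" using E'c car W by (auto simp: D_def)
  have E_D: "E = D + outer Y (para_conj_vec W)"
    using Ec car W by (intro eq_matI) (auto simp: D_def E'_def)
  have degW: "degree (W $ i) \<le> 1" if i: "i < n" for i
  proof -
    have deg: "degree ((E *\<^sub>v Z) $ i) \<le> 1" if "i < n" for i
    proof -
      have "degree (E $$ (i, j) * [:z $ j:]) \<le> 1" if "j < n" for j
        using E that \<open>i < n\<close> unfolding para_hermitian_pencil_def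
        by (intro order.trans[OF degree_mult_le]) simp
      thus ?thesis using Ec z that by (auto simp: Z_def scalar_prod_def intro!: degree_sum_le)
    qed
    have "degree e \<le> 1"
    proof -
      have "degree ([:cnj (z $ j):] * (E *\<^sub>v Z) $ j) \<le> 1" if "j < n" for j
        using deg[OF that] by (intro order.trans[OF degree_mult_le]) simp
      thus ?thesis using Ec z unfolding e_def
        by (auto simp: scalar_prod_def Z_def simp del: index_mult_mat_vec mult_pCons_left intro!: degree_sum_le)
    qed
    hence "degree (c * Y $ i) \<le> 1"
      using i y by (intro order.trans[OF degree_mult_le]) (simp add: c_def Y_def)
    thus ?thesis using deg[OF i] i car EZ unfolding W_def by (simp add: degree_diff_le del: index_mult_mat_vec)
  qed
  have E': "para_hermitian_pencil n E'"
    unfolding para_hermitian_pencil_def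
  proof (intro conjI allI impI E'c)
    fix i j assume ij: "i < n" "j < n"
    have ent: "E' $$ (i, j) = E $$ (i, j) - (W $ i * para_conj (Y $ j) + Y $ i * para_conj (W $ j))"
      if "i < n" "j < n" for i j
      using that Ec car W by (simp add: E'_def)
    show "para_conj (E' $$ (i, j)) = E' $$ (j, i)"
      using ij E by (simp add: ent para_hermitian_pencil_def para_conj.hom_minus para_conj.hom_mult
          para_conj.hom_add mult_ac add_ac)
    have "degree (W $ i * para_conj (Y $ j)) \<le> 1" "degree (Y $ i * para_conj (W $ j)) \<le> 1"
      using degW[OF ij(1)] degW[OF ij(2)] ij y
      by (intro order.trans[OF degree_mult_le]; simp add: Y_def)+
    thus "degree (E' $$ (i, j)) \<le> 1"
      unfolding ent[OF ij] using E ij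
      by (intro degree_diff_le degree_add_le) (auto simp: para_hermitian_pencil_def)
  qed
  have Ef: "E' *\<^sub>v f = E *\<^sub>v f - ((para_conj_vec Y \<bullet> f) \<cdot>\<^sub>v W + (para_conj_vec W \<bullet> f) \<cdot>\<^sub>v Y)"
    if f: "f \<in> carrier_vec n" for f
  proof -
    have "E *\<^sub>v f = D *\<^sub>v f + (para_conj_vec W \<bullet> f) \<cdot>\<^sub>v Y"
      unfolding E_D using Dc car W f by (intro mult_add_outer_vec) auto
    moreover have "D *\<^sub>v f = E' *\<^sub>v f + (para_conj_vec Y \<bullet> f) \<cdot>\<^sub>v W"
      unfolding D_def using E'c car W f by (intro mult_add_outer_vec) auto
    ultimately show ?thesis using E'c car W f by (intro eq_vecI) auto
  qed
  have E'X: "E' *\<^sub>v X = 0\<^sub>v n"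
    unfolding Ef[OF car(1)] EX Y'X W'X using W car by (intro eq_vecI) auto
  have E'Z: "E' *\<^sub>v Z = 0\<^sub>v n"
    unfolding Ef[OF car(3)] Y'Z W'Z using W car EZ by (intro eq_vecI) (auto simp: W_def)
  have tE'X: "transpose_mat E' *\<^sub>v para_conj_vec X = 0\<^sub>v n"
    and tE'Z: "transpose_mat E' *\<^sub>v para_conj_vec Z = 0\<^sub>v n"
    using para_hermitian_left_kernel[OF E'] car E'X E'Z by auto
  have rank_D: "normal_rank D = Suc (normal_rank E')"
    unfolding D_def
    by (rule normal_rank_add_outer[where t = "para_conj_vec X" and z = Z, OF E'c])
       (use car W tE'X X'W E'Z Y'Z in auto)
  have "normal_rank E = Suc (normal_rank D)"
  proof -
    \<comment> \<open>The left kernel of E' contains X* and Z*; a combination of them also annihilates W,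
        and it still pairs with Y to a nonzero value.\<close>
    define \<alpha> where "\<alpha> = para_conj_vec X \<bullet> W"
    define \<beta> where "\<beta> = para_conj_vec Z \<bullet> W"
    define t where "t = \<alpha> \<cdot>\<^sub>v para_conj_vec Z - \<beta> \<cdot>\<^sub>v para_conj_vec X"
    have t: "t \<in> carrier_vec n" using car by (simp add: t_def)
    have "W \<bullet> t = \<alpha> * (W \<bullet> para_conj_vec Z) - \<beta> * (W \<bullet> para_conj_vec X)"
      unfolding t_def using W car by (simp add: scalar_prod_minus_distrib[of _ n])
    hence Wt: "W \<bullet> t = 0"
      using comm_scalar_prod[of W n "para_conj_vec Z"] comm_scalar_prod[of W n "para_conj_vec X"] W car
      by (simp add: \<alpha>_def \<beta>_def)
    have tY: "t \<bullet> Y = \<alpha>"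
      unfolding t_def using car X'Y Z'Y by (simp add: minus_scalar_prod_distrib[of _ n])
    have "transpose_mat E' *\<^sub>v t = \<alpha> \<cdot>\<^sub>v (transpose_mat E' *\<^sub>v para_conj_vec Z)
        - \<beta> \<cdot>\<^sub>v (transpose_mat E' *\<^sub>v para_conj_vec X)"
      using mult_minus_distrib_mat_vec[of "transpose_mat E'" n n "\<alpha> \<cdot>\<^sub>v para_conj_vec Z" "\<beta> \<cdot>\<^sub>v para_conj_vec X"]
        E'c car
      by (simp add: t_def mult_mat_smult_vec)
    also have "\<dots> = 0\<^sub>v n" unfolding tE'X tE'Z by (intro eq_vecI) auto
    finally have tE't: "transpose_mat E' *\<^sub>v t = 0\<^sub>v n" .
    have "transpose_mat D = transpose_mat E' + outer (para_conj_vec Y) W"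
      unfolding D_def using E'c car W by (subst transpose_add[of _ n n]) (auto simp: transpose_outer)
    hence tD: "transpose_mat D *\<^sub>v t = 0\<^sub>v n"
      using mult_add_outer_vec[of "transpose_mat E'" n n "para_conj_vec Y" W t] E'c car W t Wt tE't
      by (auto intro!: eq_vecI)
    have DX: "D *\<^sub>v X = 0\<^sub>v n"
      unfolding D_def using mult_add_outer_vec[OF E'c, of W "para_conj_vec Y" X] W car E'X Y'X
      by (auto intro!: eq_vecI)
    show ?thesis unfolding E_D
      by (rule normal_rank_add_outer[where t = t and z = X, OF Dc])
         (use car W t tD tY DX W'X p X'W in \<open>auto simp: \<alpha>_def\<close>)
  qed
  hence "normal_rank E = normal_rank E' + 2" using rank_D by simp
  moreover have "E = E' + mult_star Y (reflect_vec W) + mult_star (reflect_vec (reflect_vec W)) Y"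
    unfolding reflect_vec_reflect_vec mult_star_reflect_vec
    unfolding Y_def mult_star_const
    unfolding Y_def[symmetric] using Ec W car by (intro eq_matI) (auto simp: E'_def)
  moreover have "vec_degree (reflect_vec W) \<le> 1"
    using W degW by (intro vec_degree_le) (auto simp: reflect_vec_def degree_pcompose)
  ultimately show thesis
    using E' y W unfolding Y_def by (intro that[of E' y "reflect_vec W"]) (auto simp: reflect_vec_def)
qed

section \<open>Assembling the decomposition\<close>

definition symmetric_decomposition ::
    "nat \<Rightarrow> complex poly mat \<Rightarrow> nat \<Rightarrow> nat \<Rightarrow> bool" where
  "symmetric_decomposition n E l s \<longleftrightarrow>
    (\<exists>(a :: nat \<Rightarrow> real) (b :: nat \<Rightarrow> real)
           (u :: nat \<Rightarrow> complex poly vec) (v :: nat \<Rightarrow> complex poly vec) (w :: nat \<Rightarrow> complex poly vec).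
           (\<forall>i<l. u i \<in> carrier_vec n) \<and>
           (\<forall>j<s. v j \<in> carrier_vec n \<and> w j \<in> carrier_vec n) \<and>
           E = mat_sum n (\<lambda>i. [:complex_of_real (a i), complex_of_real (b i) * \<i>:] \<cdot>\<^sub>m mult_star (u i) (u i)) {..<l}
             + mat_sum n (\<lambda>j. mult_star (v j) (w j)) {..<s}
             + mat_sum n (\<lambda>j. mult_star (reflect_vec (w j)) (v j)) {..<s} \<and>
           (\<forall>i<l. vec_degree (u i) = 0) \<and>
           (\<forall>j<s. vec_degree (v j) = 0 \<and> vec_degree (w j) \<le> 1))"

lemma mat_sum_lessThan_Suc:
  assumes "\<And>i j. i < n \<Longrightarrow> j < n \<Longrightarrow> G $$ (i, j) = F k $$ (i, j)" "G \<in> carrier_mat n n"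
    and "\<And>i. i < k \<Longrightarrow> F i = F' i"
  shows "mat_sum n F {..<Suc k} = mat_sum n F' {..<k} + G"
  using assms by (intro eq_matI) (auto simp: mat_sum_def)

lemma vec_degree_const_vec: "vec_degree (const_vec x) = 0"
  using vec_degree_le[of "const_vec x" 0] by simp

lemma mult_star_carrier:
  "v \<in> carrier_vec n \<Longrightarrow> w \<in> carrier_vec n \<Longrightarrow> mult_star v w \<in> carrier_mat n n"
  by (auto simp: mult_star_def)

lemma mat_sum_carrier: "mat_sum n F I \<in> carrier_mat n n"
  by (simp add: mat_sum_def)

lemma add_mat_into_first:
  fixes A B C G :: "'a::ab_semigroup_add mat"
  assumes "A \<in> carrier_mat n m" "B \<in> carrier_mat n m" "C \<in> carrier_mat n m" "G \<in> carrier_mat n m"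
  shows "A + B + C + G = A + G + B + C"
  using assms by (intro eq_matI) (simp_all add: add_ac)

lemma add_mat_into_second_and_third:
  fixes A B C G G' :: "'a::ab_semigroup_add mat"
  assumes "A \<in> carrier_mat n m" "B \<in> carrier_mat n m" "C \<in> carrier_mat n m"
    "G \<in> carrier_mat n m" "G' \<in> carrier_mat n m"
  shows "A + B + C + G + G' = A + (B + G) + (C + G')"
  using assms by (intro eq_matI) (simp_all add: add_ac)

lemma symmetric_decomposition_zero: "symmetric_decomposition n (0\<^sub>m n n) 0 0"
  unfolding symmetric_decomposition_def
  by (auto simp: mat_sum_def intro!: eq_matI)

lemma symmetric_decomposition_add_rank_one:
  assumes D: "symmetric_decomposition n E l s" and u0: "u0 \<in> carrier_vec n"
  shows "symmetric_decomposition n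
    (E + [:complex_of_real a0, complex_of_real b0 * \<i>:] \<cdot>\<^sub>m mult_star (const_vec u0) (const_vec u0)) (Suc l) s"
proof -
  let ?q = "\<lambda>a b. [:complex_of_real a, complex_of_real b * \<i>:]"
  obtain a b u v w where D: "\<forall>i<l. u i \<in> carrier_vec n"
      "\<forall>j<s. v j \<in> carrier_vec n \<and> w j \<in> carrier_vec n"
      "\<forall>i<l. vec_degree (u i) = 0" "\<forall>j<s. vec_degree (v j) = 0 \<and> vec_degree (w j) \<le> 1"
    and E: "E = mat_sum n (\<lambda>i. ?q (a i) (b i) \<cdot>\<^sub>m mult_star (u i) (u i)) {..<l}
             + mat_sum n (\<lambda>j. mult_star (v j) (w j)) {..<s}
             + mat_sum n (\<lambda>j. mult_star (reflect_vec (w j)) (v j)) {..<s}"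
    using D unfolding symmetric_decomposition_def by blast
  define a' where "a' = a(l := a0)"
  define b' where "b' = b(l := b0)"
  define u' where "u' = u(l := const_vec u0)"
  let ?G = "?q a0 b0 \<cdot>\<^sub>m mult_star (const_vec u0) (const_vec u0)"
  have G: "?G \<in> carrier_mat n n" using u0 by (simp add: mult_star_carrier)
  have sum: "mat_sum n (\<lambda>i. ?q (a' i) (b' i) \<cdot>\<^sub>m mult_star (u' i) (u' i)) {..<Suc l}
      = mat_sum n (\<lambda>i. ?q (a i) (b i) \<cdot>\<^sub>m mult_star (u i) (u i)) {..<l} + ?G"
    using G by (intro mat_sum_lessThan_Suc) (auto simp: a'_def b'_def u'_def)
  have "E + ?G = mat_sum n (\<lambda>i. ?q (a' i) (b' i) \<cdot>\<^sub>m mult_star (u' i) (u' i)) {..<Suc l}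
             + mat_sum n (\<lambda>j. mult_star (v j) (w j)) {..<s}
             + mat_sum n (\<lambda>j. mult_star (reflect_vec (w j)) (v j)) {..<s}"
    unfolding sum E
    by (intro add_mat_into_first[of _ n n] mat_sum_carrier G)
  moreover have "\<forall>i<Suc l. u' i \<in> carrier_vec n" "\<forall>i<Suc l. vec_degree (u' i) = 0"
    using D u0 by (auto simp: u'_def less_Suc_eq vec_degree_const_vec)
  ultimately show ?thesis
    unfolding symmetric_decomposition_def using D by blast
qed

lemma symmetric_decomposition_add_rank_two:
  assumes D: "symmetric_decomposition n E l s"
    and v0: "v0 \<in> carrier_vec n" and w0: "w0 \<in> carrier_vec n" "vec_degree w0 \<le> 1"
  shows "symmetric_decomposition n
    (E + mult_star (const_vec v0) w0 + mult_star (reflect_vec w0) (const_vec v0)) l (Suc s)"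
proof -
  let ?q = "\<lambda>a b. [:complex_of_real a, complex_of_real b * \<i>:]"
  obtain a b u v w where D: "\<forall>i<l. u i \<in> carrier_vec n"
      "\<forall>j<s. v j \<in> carrier_vec n \<and> w j \<in> carrier_vec n"
      "\<forall>i<l. vec_degree (u i) = 0" "\<forall>j<s. vec_degree (v j) = 0 \<and> vec_degree (w j) \<le> 1"
    and E: "E = mat_sum n (\<lambda>i. ?q (a i) (b i) \<cdot>\<^sub>m mult_star (u i) (u i)) {..<l}
             + mat_sum n (\<lambda>j. mult_star (v j) (w j)) {..<s}
             + mat_sum n (\<lambda>j. mult_star (reflect_vec (w j)) (v j)) {..<s}"
    using D unfolding symmetric_decomposition_def by blast
  define v' where "v' = v(s := const_vec v0)"
  define w' where "w' = w(s := w0)"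
  let ?G = "mult_star (const_vec v0) w0" and ?G' = "mult_star (reflect_vec w0) (const_vec v0)"
  have G: "?G \<in> carrier_mat n n" "?G' \<in> carrier_mat n n"
    using v0 w0 by (auto intro!: mult_star_carrier simp: reflect_vec_def)
  have sum: "mat_sum n (\<lambda>j. mult_star (v' j) (w' j)) {..<Suc s}
      = mat_sum n (\<lambda>j. mult_star (v j) (w j)) {..<s} + ?G"
    using G by (intro mat_sum_lessThan_Suc) (auto simp: v'_def w'_def)
  have sum': "mat_sum n (\<lambda>j. mult_star (reflect_vec (w' j)) (v' j)) {..<Suc s}
      = mat_sum n (\<lambda>j. mult_star (reflect_vec (w j)) (v j)) {..<s} + ?G'"
    using G by (intro mat_sum_lessThan_Suc) (auto simp: v'_def w'_def)
  have "E + ?G + ?G' = mat_sum n (\<lambda>i. ?q (a i) (b i) \<cdot>\<^sub>m mult_star (u i) (u i)) {..<l}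
             + mat_sum n (\<lambda>j. mult_star (v' j) (w' j)) {..<Suc s}
             + mat_sum n (\<lambda>j. mult_star (reflect_vec (w' j)) (v' j)) {..<Suc s}"
    unfolding sum sum' E
    by (intro add_mat_into_second_and_third[of _ n n] mat_sum_carrier G)
  moreover have "\<forall>j<Suc s. v' j \<in> carrier_vec n \<and> w' j \<in> carrier_vec n"
      "\<forall>j<Suc s. vec_degree (v' j) = 0 \<and> vec_degree (w' j) \<le> 1"
    using D v0 w0 by (auto simp: v'_def w'_def less_Suc_eq vec_degree_const_vec)
  ultimately show ?thesis
    unfolding symmetric_decomposition_def using D by blast
qed

text \<open>Induction on the normal rank: an eigenvector exists as long as the pencil is nonzero, and it
is either isotropic or not.\<close>

lemma para_hermitian_decomposition:
  assumes "para_hermitian_pencil n E"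
  shows "\<exists>l s. symmetric_decomposition n E l s \<and> l + 2 * s = normal_rank E"
  using assms
proof (induction "normal_rank E" arbitrary: E rule: less_induct)
  case less
  note E = less.prems
  show ?case
  proof (cases "E = 0\<^sub>m n n")
    case True
    have "map_mat to_fract E = 0\<^sub>m n n" unfolding True by (intro eq_matI) auto
    hence "normal_rank E = 0" using vec_space.rank_0I by (simp add: normal_rank_def True)
    thus ?thesis using symmetric_decomposition_zero[of n] True by (intro exI[of _ 0]) simp
  next
    case False
    then obtain x y p where xy: "x \<in> carrier_vec n" "y \<in> carrier_vec n" "y \<noteq> 0\<^sub>v n"
      and p: "p \<noteq> 0" "degree p \<le> 1" and Ex: "E *\<^sub>v const_vec x = p \<cdot>\<^sub>v const_vec y"
      using para_hermitian_pencil_eigenvector[OF E] by blast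
    show ?thesis
    proof (cases "y \<bullet>c x = 0")
      case True
      obtain E' v w where E': "para_hermitian_pencil n E'" and vw: "v \<in> carrier_vec n"
        "w \<in> carrier_vec n" "vec_degree w \<le> 1"
        and E_eq: "E = E' + mult_star (const_vec v) w + mult_star (reflect_vec w) (const_vec v)"
        and rank: "normal_rank E = normal_rank E' + 2"
        using para_hermitian_split_isotropic[OF E xy Ex p(1) True] by metis
      obtain l s where "symmetric_decomposition n E' l s" "l + 2 * s = normal_rank E'"
        using less.hyps[OF _ E'] rank by auto
      thus ?thesis
        using symmetric_decomposition_add_rank_two[of n E' l s v w] vw rank
        unfolding E_eq[symmetric] by (intro exI[of _ l] exI[of _ "Suc s"]) simp
    next
      case False
      obtain E' u a b where E': "para_hermitian_pencil n E'" and u: "u \<in> carrier_vec n"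
        and E_eq: "E = E' + [:complex_of_real a, complex_of_real b * \<i>:] \<cdot>\<^sub>m mult_star (const_vec u) (const_vec u)"
        and rank: "normal_rank E = Suc (normal_rank E')"
        using para_hermitian_split_nonisotropic[OF E xy(1,2) Ex p False] by metis
      obtain l s where "symmetric_decomposition n E' l s" "l + 2 * s = normal_rank E'"
        using less.hyps[OF _ E'] rank by auto
      thus ?thesis
        using symmetric_decomposition_add_rank_one[of n E' l s u a b] u rank
        unfolding E_eq[symmetric] by (intro exI[of _ "Suc l"] exI[of _ s]) simp
    qed
  qed
qed

theorem theorem11:
  fixes n r :: nat and E :: "complex poly mat"
  assumes "star_even_pencil n E"
    and "normal_rank E = r" and "r \<le> n"
  shows "\<exists>(l::nat) (s::nat) (a :: nat \<Rightarrow> real) (b :: nat \<Rightarrow> real)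
           (u :: nat \<Rightarrow> complex poly vec) (v :: nat \<Rightarrow> complex poly vec) (w :: nat \<Rightarrow> complex poly vec).
           (\<forall>i<l. u i \<in> carrier_vec n) \<and>
           (\<forall>j<s. v j \<in> carrier_vec n \<and> w j \<in> carrier_vec n) \<and>
           E = mat_sum n (\<lambda>i. [:complex_of_real (a i), complex_of_real (b i) * \<i>:] \<cdot>\<^sub>m mult_star (u i) (u i)) {..<l}
             + mat_sum n (\<lambda>j. mult_star (v j) (w j)) {..<s}
             + mat_sum n (\<lambda>j. mult_star (reflect_vec (w j)) (v j)) {..<s} \<and>
           l + 2 * s = r \<and>
           (\<forall>i<l. vec_degree (u i) = 0) \<and>
           (\<forall>j<s. vec_degree (v j) = 0 \<and> vec_degree (w j) \<le> 1)"
proof -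
  obtain l s where "symmetric_decomposition n E l s" and rank: "l + 2 * s = r"
    using para_hermitian_decomposition[OF star_even_pencil_imp_para_hermitian[OF assms(1)]] assms(2)
    by auto
  then obtain a b u v w where
      "\<forall>i<l. u i \<in> carrier_vec n" "\<forall>j<s. v j \<in> carrier_vec n \<and> w j \<in> carrier_vec n"
      "E = mat_sum n (\<lambda>i. [:complex_of_real (a i), complex_of_real (b i) * \<i>:] \<cdot>\<^sub>m mult_star (u i) (u i)) {..<l}
             + mat_sum n (\<lambda>j. mult_star (v j) (w j)) {..<s}
             + mat_sum n (\<lambda>j. mult_star (reflect_vec (w j)) (v j)) {..<s}"
      "\<forall>i<l. vec_degree (u i) = 0" "\<forall>j<s. vec_degree (v j) = 0 \<and> vec_degree (w j) \<le> 1"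
    unfolding symmetric_decomposition_def by blast
  with rank show ?thesis by blast
qed

end
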